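(* Let $G$ be a bipartite graph with bipartition $(U,W)$, let $M$ be a perfect matching of $G$, and let $k$ be a positive integer. If $G$ is minimal $k$-extendable, then $D=D(G,M)$ is minimal $k$-strong.
   Context: All graphs are finite and simple, and all digraphs are finite with no loops and no multiple arcs. For a bipartite graph $G$ with bipartition $(U,W)$ and a perfect matching $M$, the digraph $D(G,M)$ is defined as follows. Its vertex set is $M$. For distinct edges $e=uw$ and $e'=u'w'$ of $M$ with $u,u'\in U$ and $w,w'\in W$, there is an arc from $e$ to $e'$ if and only if $uw'\in E(G)$. A digraph is strong if for any two distinct vertices $x,y$ there are directed paths from $x$ to $y$ and from $y$ to $x$. A set $S\subset V(D)$ is a separator if $D-S$ is not strong. $D$ is $k$-strong if $|V(D)|\ge k+1$ and $D$ has no separator of order less than $k$. $D$ is minimal $k$-strong if it is $k$-strong but $D-a$ is not $k$-strong for every arc $a$. A connected graph $G$ is $k$-extendable (for $k\le(|V(G)|-1)/2$) if $G$ has a matching of size $k$ and every matching of size $k$ is contained in a perfect matching of $G$. $G$ is minimal $k$-extendable if it is $k$-extendable but $G-e$ is not $k$-extendable for every edge $e\in E(G)$. *)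

theory Defs
  imports Main
begin

section \<open>Finite simple graphs: vertex set V, edges are 2-element subsets of V\<close>

definition simple_graph :: "'a set \<Rightarrow> 'a set set \<Rightarrow> bool" where
  "simple_graph V E \<longleftrightarrow> finite V \<and>
     (\<forall>e\<in>E. \<exists>u v. e = {u, v} \<and> u \<noteq> v \<and> u \<in> V \<and> v \<in> V)"

definition graph_connected :: "'a set \<Rightarrow> 'a set set \<Rightarrow> bool" where
  "graph_connected V E \<longleftrightarrow>
     (\<forall>u\<in>V. \<forall>v\<in>V. (u, v) \<in> {(x, y). {x, y} \<in> E}\<^sup>*)"

text \<open>(U,W) is a bipartition of G = (V,E).\<close>
definition bipartition :: "'a set \<Rightarrow> 'a set set \<Rightarrow> 'a set \<Rightarrow> 'a set \<Rightarrow> bool" where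
  "bipartition V E U W \<longleftrightarrow> U \<inter> W = {} \<and> U \<union> W = V \<and>
     (\<forall>e\<in>E. \<exists>u\<in>U. \<exists>w\<in>W. e = {u, w})"

definition matching :: "'a set set \<Rightarrow> 'a set set \<Rightarrow> bool" where
  "matching E M \<longleftrightarrow> M \<subseteq> E \<and> (\<forall>e\<in>M. \<forall>e'\<in>M. e \<noteq> e' \<longrightarrow> e \<inter> e' = {})"

definition perfect_matching :: "'a set \<Rightarrow> 'a set set \<Rightarrow> 'a set set \<Rightarrow> bool" where
  "perfect_matching V E M \<longleftrightarrow> matching E M \<and> \<Union>M = V"

text \<open>G is k-extendable (with the standing range condition k \<le> (|V|-1)/2).\<close>
definition k_extendable :: "nat \<Rightarrow> 'a set \<Rightarrow> 'a set set \<Rightarrow> bool" where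
  "k_extendable k V E \<longleftrightarrow> simple_graph V E \<and> graph_connected V E \<and>
     2 * k + 1 \<le> card V \<and>
     (\<exists>N. matching E N \<and> card N = k) \<and>
     (\<forall>N. matching E N \<and> card N = k \<longrightarrow> (\<exists>P. perfect_matching V E P \<and> N \<subseteq> P))"

definition minimal_k_extendable :: "nat \<Rightarrow> 'a set \<Rightarrow> 'a set set \<Rightarrow> bool" where
  "minimal_k_extendable k V E \<longleftrightarrow> k_extendable k V E \<and>
     (\<forall>e\<in>E. \<not> k_extendable k V (E - {e}))"

section \<open>Digraphs: vertex set V, arc set A \<subseteq> V \<times> V\<close>

definition strong :: "'v set \<Rightarrow> ('v \<times> 'v) set \<Rightarrow> bool" where
  "strong V A \<longleftrightarrow> (\<forall>x\<in>V. \<forall>y\<in>V. x \<noteq> y \<longrightarrow> (x, y) \<in> (A \<inter> (V \<times> V))\<^sup>+)"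

text \<open>S is a separator: proper subset whose deletion leaves a non-strong digraph.\<close>
definition separator :: "'v set \<Rightarrow> ('v \<times> 'v) set \<Rightarrow> 'v set \<Rightarrow> bool" where
  "separator V A S \<longleftrightarrow> S \<subset> V \<and> \<not> strong (V - S) (A \<inter> ((V - S) \<times> (V - S)))"

definition k_strong :: "nat \<Rightarrow> 'v set \<Rightarrow> ('v \<times> 'v) set \<Rightarrow> bool" where
  "k_strong k V A \<longleftrightarrow> finite V \<and> card V \<ge> k + 1 \<and>
     (\<forall>S. separator V A S \<longrightarrow> card S \<ge> k)"

definition minimal_k_strong :: "nat \<Rightarrow> 'v set \<Rightarrow> ('v \<times> 'v) set \<Rightarrow> bool" where
  "minimal_k_strong k V A \<longleftrightarrow> k_strong k V A \<and> (\<forall>a\<in>A. \<not> k_strong k V (A - {a}))"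

section \<open>The digraph D(G,M)\<close>

definition DGM_arcs :: "'a set \<Rightarrow> 'a set \<Rightarrow> 'a set set \<Rightarrow> 'a set set \<Rightarrow> ('a set \<times> 'a set) set" where
  "DGM_arcs U W E M = {(e, e'). e \<in> M \<and> e' \<in> M \<and> e \<noteq> e' \<and>
     (\<exists>u w u' w'. u \<in> U \<and> u' \<in> U \<and> w \<in> W \<and> w' \<in> W \<and>
        e = {u, w} \<and> e' = {u', w'} \<and> {u, w'} \<in> E)}"

end

theory Submission
  imports Defs
begin

text \<open>
  Let \<open>n = |U| = |W|\<close> and let \<open>N(X)\<close> be the set of neighbours of \<open>X\<close>. Both \<open>k\<close>-extendability of \<open>G\<close>
  and \<open>k\<close>-strength of \<open>D(G,M)\<close> are equivalent to \<open>n \<ge> k + 1\<close> together with the surplus condition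
  that every nonempty \<open>X \<subseteq> U\<close> has \<open>N(X) = W\<close> or \<open>|N(X)| \<ge> |X| + k\<close>. For the digraph this is because
  the closed out-neighbourhood of a set of edges of \<open>M\<close> corresponds to \<open>N(X)\<close>; for the graph it rests
  on Hall's theorem. Deleting an arc of \<open>D(G,M)\<close> amounts to deleting an edge of \<open>G\<close> outside \<open>M\<close>, so
  minimality carries over as well.
\<close>

section \<open>Hall's theorem\<close>

text \<open>Halmos-Vaughan induction on \<open>card I\<close>. If some nonempty proper subfamily
  meets its bound with equality, it and the remaining indices are solved separately; otherwise every
  such subfamily has an element to spare, and one choice can be fixed freely.\<close>

theorem hall:
  assumes "finite I" and "\<And>i. i \<in> I \<Longrightarrow> finite (A i)"
    and "\<And>J. J \<subseteq> I \<Longrightarrow> card J \<le> card (\<Union>(A ` J))"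
  shows "\<exists>f. inj_on f I \<and> (\<forall>i\<in>I. f i \<in> A i)"
  using assms
proof (induction "card I" arbitrary: I A rule: less_induct)
  case (less I A)
  note fin = less.prems(1) and finA = less.prems(2) and H = less.prems(3)
  have finU: "finite (\<Union>(A ` J))" if "J \<subseteq> I" for J
    using that fin finA by (intro finite_UN_I) (auto dest: finite_subset)
  show ?case
  proof (cases "\<exists>J. J \<subseteq> I \<and> J \<noteq> {} \<and> J \<noteq> I \<and> card J = card (\<Union>(A ` J))")
    case True
    then obtain J where J: "J \<subseteq> I" "J \<noteq> {}" "J \<noteq> I" "card J = card (\<Union>(A ` J))" by blast
    have finJ: "finite J" using finite_subset[OF J(1) fin] .
    have "card J < card I" using J(1,3) fin by (intro psubset_card_mono) auto
    then obtain f where f: "inj_on f J" "\<forall>i\<in>J. f i \<in> A i"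
      using less.hyps[of J A] finJ finA H J(1) by (auto dest: order_trans)
    \<comment> \<open>Deleting everything the tight \<open>J\<close> may use keeps the condition:
      the bound holds for \<open>K \<union> J\<close>, and \<open>J\<close> accounts for only
      \<open>card J\<close> elements of that union.\<close>
    define B where "B i = A i - \<Union>(A ` J)" for i
    have "card (I - J) < card I"
      using J(1,2) fin by (intro psubset_card_mono) auto
    moreover have "card K \<le> card (\<Union>(B ` K))" if K: "K \<subseteq> I - J" for K
    proof -
      have finK: "finite K" using K fin by (meson Diff_subset finite_subset)
      have "card (K \<union> J) \<le> card (\<Union>(A ` (K \<union> J)))" using H[of "K \<union> J"] K J(1) by blast
      moreover have "card (K \<union> J) = card K + card J" using K finK finJ by (intro card_Un_disjoint) auto
      moreover have "\<Union>(A ` (K \<union> J)) = \<Union>(B ` K) \<union> \<Union>(A ` J)" unfolding B_def by auto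
      moreover have "card (\<Union>(B ` K) \<union> \<Union>(A ` J)) \<le> card (\<Union>(B ` K)) + card (\<Union>(A ` J))"
        by (rule card_Un_le)
      ultimately show ?thesis using J(4) by simp
    qed
    ultimately obtain g where g: "inj_on g (I - J)" "\<forall>i\<in>I-J. g i \<in> B i"
      using less.hyps[of "I - J" B] fin finA unfolding B_def by fastforce
    have "inj_on (\<lambda>i. if i \<in> J then f i else g i) I"
      using f g unfolding inj_on_def B_def by (smt (verit) Diff_iff UN_I)
    moreover have "\<forall>i\<in>I. (if i \<in> J then f i else g i) \<in> A i" using f g B_def by auto
    ultimately show ?thesis by (intro exI[of _ "\<lambda>i. if i \<in> J then f i else g i"]) simp
  next
    case False
    show ?thesis
    proof (cases "I = {}")
      case nonempty: False
      then obtain i where i: "i \<in> I" by blast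
      have "card {i} \<le> card (\<Union>(A ` {i}))" using H[of "{i}"] i by blast
      then have "A i \<noteq> {}" by auto
      then obtain a where a: "a \<in> A i" by blast
      \<comment> \<open>Deleting \<open>a\<close> costs a union at most one element, which the
        strict inequality for nonempty proper subfamilies pays for.\<close>
      define B where "B j = A j - {a}" for j
      have "card (I - {i}) < card I" using fin i by (rule card_Diff1_less)
      moreover have "card K \<le> card (\<Union>(B ` K))" if K: "K \<subseteq> I - {i}" for K
      proof (cases "K = {}")
        case Kne: False
        have "card K \<noteq> card (\<Union>(A ` K))" using False K Kne i by blast
        moreover have "card K \<le> card (\<Union>(A ` K))" using H[of K] K by blast
        moreover have "\<Union>(B ` K) = \<Union>(A ` K) - {a}" unfolding B_def by auto
        moreover have "card (\<Union>(A ` K)) - 1 \<le> card (\<Union>(A ` K) - {a})"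
          using finU[of K] K by (simp add: card_Diff_singleton_if)
        ultimately show ?thesis by simp
      qed simp
      ultimately obtain g where g: "inj_on g (I - {i})" "\<forall>j\<in>I-{i}. g j \<in> B j"
        using less.hyps[of "I - {i}" B] fin finA unfolding B_def by fastforce
      have "inj_on (g(i := a)) I"
        using g unfolding inj_on_def B_def by auto
      moreover have "\<forall>j\<in>I. (g(i := a)) j \<in> A j" using g a B_def by auto
      ultimately show ?thesis by blast
    qed simp
  qed
qed

text \<open>The deficit is absorbed by \<open>m\<close> dummy elements that belong to every set.\<close>

lemma hall_deficit:
  assumes fin: "finite I" "\<And>i. i \<in> I \<Longrightarrow> finite (A i)"
    and H: "\<And>J. J \<subseteq> I \<Longrightarrow> card J \<le> card (\<Union>(A ` J)) + m"
  shows "\<exists>J f. J \<subseteq> I \<and> card I \<le> card J + m \<and> inj_on f J \<and> (\<forall>i\<in>J. f i \<in> A i)"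
proof -
  define B where "B i = Inl ` A i \<union> Inr ` {..<m}" for i
  have "card J \<le> card (\<Union>(B ` J))" if J: "J \<subseteq> I" for J
  proof (cases "J = {}")
    case False
    have finU: "finite (\<Union>(A ` J))" using J fin by (intro finite_UN_I) (auto dest: finite_subset)
    have "\<Union>(B ` J) = Inl ` (\<Union>(A ` J)) \<union> Inr ` {..<m}" using False unfolding B_def by auto
    also have "card \<dots> = card (Inl ` (\<Union>(A ` J)) :: ('b + nat) set) + card (Inr ` {..<m} :: ('b + nat) set)"
      using finU by (intro card_Un_disjoint) auto
    also have "\<dots> = card (\<Union>(A ` J)) + m" by (simp add: card_image)
    finally show ?thesis using H[OF J] by simp
  qed simp
  then obtain g where g: "inj_on g I" "\<forall>i\<in>I. g i \<in> B i"
    using hall[of I B] fin unfolding B_def by fastforce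
  \<comment> \<open>Outside \<open>J\<close> the injective \<open>g\<close> takes distinct dummies,
    so at most \<open>m\<close> indices are lost.\<close>
  define J where "J = {i \<in> I. isl (g i)}"
  have "g ` (I - J) \<subseteq> Inr ` {..<m}" using g(2) unfolding J_def B_def by auto
  then have "card (g ` (I - J)) \<le> card (Inr ` {..<m} :: ('b + nat) set)" by (intro card_mono) auto
  moreover have "card (g ` (I - J)) = card (I - J)"
    using g(1) by (intro card_image) (auto simp: inj_on_def)
  moreover have "card I = card J + card (I - J)"
    using fin unfolding J_def by (metis (no_types, lifting) card_Diff_subset card_mono finite_subset le_add_diff_inverse mem_Collect_eq subsetI)
  ultimately have "card I \<le> card J + m" by (simp add: card_image)
  moreover have "inj_on (projl \<circ> g) J"
    using g(1) unfolding J_def inj_on_def by (auto simp: isl_def)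
  moreover have "\<forall>i\<in>J. (projl \<circ> g) i \<in> A i" using g(2) unfolding J_def B_def by auto
  moreover have "J \<subseteq> I" unfolding J_def by auto
  ultimately show ?thesis by blast
qed

section \<open>Strong connectivity and out-neighbourhoods\<close>

text \<open>Separators and violating sets determine each other. The out-neighbours of
  \<open>X\<close> outside \<open>X\<close> cut \<open>X\<close> off from whatever its closed
  out-neighbourhood misses. Conversely, if \<open>y\<close> is unreachable from \<open>x\<close>
  after deleting \<open>S\<close>, the set reachable from \<open>x\<close> has out-neighbours
  outside itself only in \<open>S\<close>.\<close>

lemma k_strong_iff_out_neighbours:
  assumes fin: "finite V" and A: "A \<subseteq> V \<times> V"
  shows "k_strong k V A \<longleftrightarrow> k + 1 \<le> card V \<and>
    (\<forall>X. X \<subseteq> V \<longrightarrow> X \<noteq> {} \<longrightarrow> A `` X \<union> X = V \<or> card X + k \<le> card (A `` X \<union> X))"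
proof -
  have sepI: "\<exists>S. separator V A S \<and> card S < k"
    if X: "X \<subseteq> V" "X \<noteq> {}" "A `` X \<union> X \<noteq> V" "card (A `` X \<union> X) < card X + k" for X
  proof -
    define S where "S = A `` X - X"
    have sub: "A `` X \<union> X \<subseteq> V" using A X by auto
    have finX: "finite X" "finite S" using sub fin finite_subset unfolding S_def by fastforce+
    have "A `` X \<union> X = S \<union> X" unfolding S_def by auto
    moreover have "card (S \<union> X) = card S + card X"
      using finX by (intro card_Un_disjoint) (auto simp: S_def)
    ultimately have "card (A `` X \<union> X) = card S + card X" by simp
    then have c: "card S < k" using X by simp
    obtain x y where xy: "x \<in> X" "y \<in> V" "y \<notin> A `` X \<union> X" using X sub by blast
    have closed: "z \<in> X" if "(x, z) \<in> (A \<inter> ((V - S) \<times> (V - S)) \<inter> ((V - S) \<times> (V - S)))\<^sup>+" for z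
      using that
    proof (induction rule: trancl_induct)
      case (base z) then show ?case using xy S_def by blast
    next
      case (step z z') then show ?case using S_def by blast
    qed
    have "\<not> strong (V - S) (A \<inter> ((V - S) \<times> (V - S)))"
    proof
      assume "strong (V - S) (A \<inter> ((V - S) \<times> (V - S)))"
      moreover have "x \<in> V - S" "y \<in> V - S" "x \<noteq> y" using xy X S_def by auto
      ultimately have "y \<in> X" using closed unfolding strong_def by blast
      then show False using xy by blast
    qed
    moreover have "S \<subset> V" using sub xy X unfolding S_def by blast
    ultimately show ?thesis using c unfolding separator_def by blast
  qed
  have sepD: "\<exists>X. X \<subseteq> V \<and> X \<noteq> {} \<and> A `` X \<union> X \<noteq> V \<and> card (A `` X \<union> X) < card X + k"
    if S: "separator V A S" "card S < k" for S
  proof -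
    define B where "B = A \<inter> ((V - S) \<times> (V - S))"
    obtain x y where xy: "x \<in> V - S" "y \<in> V - S" "(x, y) \<notin> B\<^sup>+" "x \<noteq> y"
      using S unfolding separator_def strong_def B_def by (auto simp: Int_assoc)
    define X where "X = {z. (x, z) \<in> B\<^sup>*}"
    have xX: "x \<in> X" unfolding X_def by simp
    have XV: "X \<subseteq> V - S"
    proof
      fix z assume "z \<in> X"
      then have "(x, z) \<in> B\<^sup>*" unfolding X_def by simp
      then show "z \<in> V - S" by (cases rule: rtranclE) (use xy B_def in auto)
    qed
    have yX: "y \<notin> X" using xy unfolding X_def by (auto simp: rtrancl_eq_or_trancl)
    have sub: "A `` X \<union> X \<subseteq> X \<union> S"
    proof -
      have "z' \<in> X" if "z \<in> X" "(z, z') \<in> A" "z' \<notin> S" for z z'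
      proof -
        have "(z, z') \<in> B" using that XV A unfolding B_def by auto
        then show ?thesis using that(1) unfolding X_def by (auto intro: rtrancl_into_rtrancl)
      qed
      then show ?thesis by blast
    qed
    have finS: "finite S" "finite X"
      using S(1) XV fin unfolding separator_def by (auto dest: finite_subset)
    have "card (A `` X \<union> X) \<le> card (X \<union> S)" using sub finS by (intro card_mono) auto
    also have "\<dots> \<le> card X + card S" by (rule card_Un_le)
    finally have "card (A `` X \<union> X) < card X + k" using S(2) by simp
    moreover have "A `` X \<union> X \<noteq> V" using sub yX xy by blast
    ultimately show ?thesis using XV xX by blast
  qed
  show ?thesis
    unfolding k_strong_def using fin sepI sepD by (meson not_le Suc_eq_plus1)
qed

section \<open>Matchings of bipartite graphs\<close>

definition nbr :: "'a set set \<Rightarrow> 'a set \<Rightarrow> 'a set" where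
  "nbr E X = {w. \<exists>u\<in>X. {u, w} \<in> E}"

definition surplus :: "nat \<Rightarrow> 'a set \<Rightarrow> 'a set \<Rightarrow> 'a set set \<Rightarrow> bool" where
  "surplus k U W E \<longleftrightarrow>
     (\<forall>X. X \<subseteq> U \<longrightarrow> X \<noteq> {} \<longrightarrow> nbr E X = W \<or> card X + k \<le> card (nbr E X))"

lemma surplusD:
  "surplus k U W E \<Longrightarrow> X \<subseteq> U \<Longrightarrow> X \<noteq> {} \<Longrightarrow> nbr E X = W \<or> card X + k \<le> card (nbr E X)"
  unfolding surplus_def by blast

lemma matching_disjoint:
  "matching E M \<Longrightarrow> e \<in> M \<Longrightarrow> e' \<in> M \<Longrightarrow> e \<noteq> e' \<Longrightarrow> e \<inter> e' = {}"
  unfolding matching_def by simp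

lemma matching_subset: "matching E M \<Longrightarrow> N \<subseteq> M \<Longrightarrow> matching E N"
  unfolding matching_def by (simp add: subset_iff)

lemma matching_edge: "matching E M \<Longrightarrow> e \<in> M \<Longrightarrow> e \<in> E"
  unfolding matching_def by auto

locale bip_graph =
  fixes V U W :: "'a set" and E :: "'a set set"
  assumes simple: "simple_graph V E" and bip: "bipartition V E U W"
begin

lemma finite_V: "finite V" using simple unfolding simple_graph_def by blast
lemma V_eq: "V = U \<union> W" and disj: "U \<inter> W = {}" using bip unfolding bipartition_def by auto
lemma finite_U: "finite U" and finite_W: "finite W" using finite_V V_eq by auto

lemma edgeE:
  assumes "e \<in> E" obtains u w where "u \<in> U" "w \<in> W" "e = {u, w}"
  using assms bip unfolding bipartition_def by meson

lemma edge_eq_iff: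
  assumes "u \<in> U" "w \<in> W" "u' \<in> U" "w' \<in> W"
  shows "{u, w} = {u', w'} \<longleftrightarrow> u = u' \<and> w = w'"
  using assms disj by (auto simp: doubleton_eq_iff)

lemma edge_W: "{u, w} \<in> E \<Longrightarrow> u \<in> U \<Longrightarrow> w \<in> W"
proof -
  assume "{u, w} \<in> E" "u \<in> U"
  then obtain u' w' where "u' \<in> U" "w' \<in> W" "{u, w} = {u', w'}" by (metis edgeE)
  then show ?thesis using \<open>u \<in> U\<close> disj by (auto simp: doubleton_eq_iff)
qed

lemma finite_E: "finite E"
proof -
  have "e \<subseteq> V" if "e \<in> E" for e using edgeE[OF that] V_eq by auto
  then have "E \<subseteq> Pow V" by blast
  then show ?thesis using finite_V by (meson finite_Pow_iff finite_subset)
qed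

lemma nbr_subset: "X \<subseteq> U \<Longrightarrow> nbr E X \<subseteq> W"
  using edge_W unfolding nbr_def by blast

lemma finite_nbr: "X \<subseteq> U \<Longrightarrow> finite (nbr E X)"
  using finite_subset[OF nbr_subset finite_W] .

section \<open>Matchings as injections from subsets of \<open>U\<close> into
  \<open>W\<close>\<close>

lemma inj_on_edges:
  assumes "A \<subseteq> U" "f ` A \<subseteq> W" shows "inj_on (\<lambda>u. {u, f u}) A"
proof (rule inj_onI)
  fix x y assume xy: "x \<in> A" "y \<in> A" "{x, f x} = {y, f y}"
  then show "x = y" using edge_eq_iff[of x "f x" y "f y"] assms by blast
qed

lemma matching_of_fun:
  assumes "A \<subseteq> U" "inj_on f A" "\<And>u. u \<in> A \<Longrightarrow> {u, f u} \<in> E"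
  shows "matching E ((\<lambda>u. {u, f u}) ` A)"
proof -
  have W: "f u \<in> W" if "u \<in> A" for u using that assms edge_W by blast
  have "{u, f u} \<inter> {u', f u'} = {}" if "u \<in> A" "u' \<in> A" "u \<noteq> u'" for u u'
  proof -
    have "f u \<noteq> f u'" using that assms(2) by (meson inj_onD)
    moreover have "u \<noteq> f u'" "u' \<noteq> f u" using that W disj assms(1) by blast+
    ultimately show ?thesis using that(3) by auto
  qed
  then show ?thesis unfolding matching_def using assms(3) by (smt (verit) imageE image_subsetI)
qed

lemma perfect_matching_of_fun:
  assumes "bij_betw f U W" "\<And>u. u \<in> U \<Longrightarrow> {u, f u} \<in> E"
  shows "perfect_matching V E ((\<lambda>u. {u, f u}) ` U)"
proof -
  have "\<Union>((\<lambda>u. {u, f u}) ` U) = U \<union> f ` U" by auto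
  then show ?thesis
    using assms matching_of_fun[of U f] V_eq unfolding perfect_matching_def bij_betw_def by auto
qed

text \<open>In this form the size of a matching is the size of a subset of \<open>U\<close>, and
  matchings can be combined with the injections supplied by \<open>hall\<close>. The set
  \<open>A\<close> consists of the covered vertices of \<open>U\<close>.\<close>

lemma matching_as_fun:
  assumes "matching E F"
  obtains A f where "A \<subseteq> U" "inj_on f A" "f ` A \<subseteq> W" "F = (\<lambda>u. {u, f u}) ` A"
proof -
  have FE: "F \<subseteq> E" and dis: "\<And>e e'. e \<in> F \<Longrightarrow> e' \<in> F \<Longrightarrow> e \<noteq> e' \<Longrightarrow> e \<inter> e' = {}"
    using assms unfolding matching_def by blast+
  define A where "A = U \<inter> \<Union>F"
  have "\<exists>w. w \<in> W \<and> {u, w} \<in> F" if u: "u \<in> A" for u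
  proof -
    obtain e where e: "e \<in> F" "u \<in> e" "u \<in> U" using u A_def by blast
    then obtain u' w where uw: "u' \<in> U" "w \<in> W" "e = {u', w}" using FE edgeE by blast
    then have "u = u'" using e disj by blast
    then show ?thesis using uw e by blast
  qed
  then obtain f where f: "\<And>u. u \<in> A \<Longrightarrow> f u \<in> W \<and> {u, f u} \<in> F" by metis
  have "inj_on f A"
  proof (rule inj_onI)
    fix x y assume xy: "x \<in> A" "y \<in> A" "f x = f y"
    then have "{x, f x} = {y, f y}" using f dis[of "{x, f x}" "{y, f y}"] by blast
    moreover have "x \<in> U" "y \<in> U" using xy A_def by auto
    ultimately show "x = y" using f xy edge_eq_iff[of x "f x" y "f y"] by blast
  qed
  moreover have "F = (\<lambda>u. {u, f u}) ` A"
  proof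
    show "F \<subseteq> (\<lambda>u. {u, f u}) ` A"
    proof
      fix e assume e: "e \<in> F"
      then obtain u w where uw: "u \<in> U" "w \<in> W" "e = {u, w}" using FE edgeE by blast
      then have uA: "u \<in> A" using e A_def by blast
      then have "e = {u, f u}" using f[OF uA] dis[of e "{u, f u}"] e uw by blast
      then show "e \<in> (\<lambda>u. {u, f u}) ` A" using uA by blast
    qed
  qed (use f in blast)
  ultimately show ?thesis using that[of A f] f A_def by blast
qed

lemma perfect_matching_as_fun:
  assumes "perfect_matching V E P"
  obtains f where "bij_betw f U W" "P = (\<lambda>u. {u, f u}) ` U"
proof -
  obtain A f where A: "A \<subseteq> U" "inj_on f A" "f ` A \<subseteq> W" "P = (\<lambda>u. {u, f u}) ` A"
    using assms matching_as_fun unfolding perfect_matching_def by blast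
  have "\<Union>P = A \<union> f ` A" using A(4) by auto
  then have "A \<union> f ` A = U \<union> W" using assms V_eq unfolding perfect_matching_def by auto
  then have "A = U" "f ` A = W" using A disj by blast+
  then show ?thesis using A that[of f] unfolding bij_betw_def by blast
qed

lemma card_perfect_matching:
  assumes "perfect_matching V E P"
  shows "card P = card U" "card W = card U" "card V = 2 * card P"
proof -
  obtain f where f: "bij_betw f U W" "P = (\<lambda>u. {u, f u}) ` U"
    using assms by (rule perfect_matching_as_fun)
  then have "f ` U \<subseteq> W" unfolding bij_betw_def by blast
  then show cP: "card P = card U" using f inj_on_edges[of U f] by (simp add: card_image)
  show cW: "card W = card U" using f bij_betw_same_card by metis
  have "card V = card U + card W"
    using V_eq disj finite_U finite_W by (simp add: card_Un_disjoint)
  then show "card V = 2 * card P" using cP cW by simp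
qed

text \<open>\<open>P\<close> matches \<open>X\<close> into its neighbourhood, and the prescribed
  edges occupy further vertices there for \<open>A\<close>, so there must be room for both. It
  serves to refute perfect matchings whose prescribed edges crowd out \<open>X\<close>.\<close>

lemma perfect_matching_card_nbr:
  assumes P: "perfect_matching V E P" and sub: "(\<lambda>u. {u, g u}) ` A \<subseteq> P"
    and A: "A \<subseteq> U - X" "g ` A \<subseteq> nbr E X" and X: "X \<subseteq> U"
  shows "card X + card A \<le> card (nbr E X)"
proof -
  obtain f where f: "bij_betw f U W" "P = (\<lambda>u. {u, f u}) ` U"
    using P by (rule perfect_matching_as_fun)
  have PE: "P \<subseteq> E" using P unfolding perfect_matching_def matching_def by blast
  have gf: "g u = f u" if u: "u \<in> A" for u
  proof -
    obtain u' where u': "u' \<in> U" "{u, g u} = {u', f u'}" using sub u f(2) by blast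
    moreover have "u \<in> U" "g u \<in> W" "f u' \<in> W"
      using u u' A nbr_subset[OF X] f(1) unfolding bij_betw_def by blast+
    ultimately show ?thesis using edge_eq_iff by blast
  qed
  have "f ` (X \<union> A) \<subseteq> nbr E X"
  proof -
    have "f u \<in> nbr E X" if "u \<in> X" for u using that PE f(2) X unfolding nbr_def by blast
    moreover have "f u \<in> nbr E X" if "u \<in> A" for u using gf[OF that] that A by auto
    ultimately show ?thesis by blast
  qed
  then have "card (f ` (X \<union> A)) \<le> card (nbr E X)" using finite_nbr[OF X] card_mono by blast
  moreover have "card (f ` (X \<union> A)) = card (X \<union> A)"
    using f(1) A X unfolding bij_betw_def by (intro card_image) (meson Diff_subset Un_least inj_on_subset order_trans)
  moreover have "card (X \<union> A) = card X + card A"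
    using A X finite_U by (intro card_Un_disjoint) (auto dest: finite_subset)
  ultimately show ?thesis by simp
qed

section \<open>Extendability and surplus\<close>

text \<open>For an edge \<open>e\<close> disjoint from a matching that lies in a perfect matching \<open>P\<close>, exchanging the at most
  two edges of \<open>P\<close> that meet \<open>e\<close> for \<open>e\<close> leaves at least \<open>k\<close> edges.\<close>

lemma k_extendable_le:
  assumes ext: "k_extendable k V E" and P0: "perfect_matching V E P0"
    and "matching E F" "card F \<le> k"
  shows "\<exists>P. perfect_matching V E P \<and> F \<subseteq> P"
proof -
  have "finite F" using assms(3) finite_E unfolding matching_def by (auto dest: finite_subset)
  then show ?thesis using assms(3,4)
  proof (induction F rule: finite_induct)
    case empty
    then show ?case using P0 by blast
  next
    case (insert e F)
    have eE: "e \<in> E" using insert.prems(1) by (rule matching_edge) simp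
    have dise: "g \<inter> e = {}" if "g \<in> F" for g
      by (rule matching_disjoint[OF insert.prems(1)]) (use that insert.hyps(2) in auto)
    have "matching E F" using insert.prems(1) by (rule matching_subset) blast
    moreover have "card F \<le> k" using insert.prems(2) insert.hyps by simp
    ultimately obtain P where P: "perfect_matching V E P" "F \<subseteq> P" using insert.IH by blast
    have mP: "matching E P" using P(1) unfolding perfect_matching_def by blast
    have finP: "finite P" using mP finite_E unfolding matching_def by (auto dest: finite_subset)
    define Q where "Q = {g \<in> P. g \<inter> e \<noteq> {}}"
    obtain u w where uw: "e = {u, w}" using eE edgeE by metis
    \<comment> \<open>At most one edge of \<open>P\<close> contains \<open>v\<close>;
      \<open>g v\<close> is that edge, and arbitrary if there is none.\<close>
    have "\<exists>g. \<forall>h\<in>P. v \<in> h \<longrightarrow> h = g" for v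
      using matching_disjoint[OF mP] by (metis disjoint_iff)
    then obtain g where g: "\<And>v h. h \<in> P \<Longrightarrow> v \<in> h \<Longrightarrow> h = g v" by metis
    have "Q \<subseteq> {g u, g w}"
    proof
      fix h assume "h \<in> Q"
      then have "h \<in> P" "u \<in> h \<or> w \<in> h" unfolding Q_def uw by auto
      then show "h \<in> {g u, g w}" using g by blast
    qed
    then have "card Q \<le> card {g u, g w}" by (intro card_mono) auto
    also have "\<dots> \<le> 2" by (simp add: card_insert_if)
    finally have cQ: "card Q \<le> 2" .
    define R where "R = insert e (P - Q)"
    have "e \<noteq> {}" using uw by simp
    then have "e \<notin> P - Q" unfolding Q_def by blast
    then have cR: "card R = Suc (card P - card Q)"
      unfolding R_def using finP by (simp add: Q_def card_Diff_subset)
    \<comment> \<open>By parity \<open>P\<close> has at least \<open>k + 1\<close> edges, so losing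
      two and gaining \<open>e\<close> still leaves \<open>k\<close>.\<close>
    have "2 * k + 1 \<le> 2 * card P"
      using ext card_perfect_matching[OF P(1)] unfolding k_extendable_def by simp
    then have kR: "k \<le> card R" using cR cQ by linarith
    have mR: "matching E R"
    proof -
      have "g \<inter> e = {}" "e \<inter> g = {}" if "g \<in> P - Q" for g using that unfolding Q_def by auto
      then show ?thesis
        using mP eE unfolding R_def matching_def by (simp add: subset_iff)
    qed
    have FR: "insert e F \<subseteq> R" using P(2) dise unfolding R_def Q_def by blast
    have "finite R" using R_def finP by simp
    \<comment> \<open>Extendability speaks of exactly \<open>k\<close> edges, so
      \<open>insert e F\<close> is padded inside \<open>R\<close> to that size.\<close>
    then obtain K where K: "insert e F \<subseteq> K" "K \<subseteq> R" "card K = k"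
      using exists_subset_between[of "insert e F" k R] insert.prems(2) kR FR by blast
    have "matching E K" using mR K(2) by (rule matching_subset)
    then obtain P' where "perfect_matching V E P'" "K \<subseteq> P'"
      using ext K(3) unfolding k_extendable_def by blast
    then show ?case using K(1) by blast
  qed
qed

text \<open>Otherwise connectivity yields an edge leaving \<open>Y \<union> nbr E Y\<close>, which
  must join some \<open>x\<close> in the neighbourhood to some \<open>y\<close> in \<open>U\<close>
  outside \<open>Y\<close>. As \<open>k\<close> is positive, a perfect matching contains this edge;
  it spends \<open>x\<close> on \<open>y\<close> and leaves too few neighbours for
  \<open>Y\<close>.\<close>

lemma nbr_eq_W_if_card_le:
  assumes ext: "k_extendable k V E" and k: "0 < k" and P0: "perfect_matching V E P0"
    and Y: "Y \<subseteq> U" "Y \<noteq> {}" and card: "card (nbr E Y) \<le> card Y"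
  shows "nbr E Y = W"
proof (rule ccontr)
  assume "nbr E Y \<noteq> W"
  then obtain w0 where w0: "w0 \<in> W" "w0 \<notin> nbr E Y" using nbr_subset[OF Y(1)] by blast
  obtain u0 where u0: "u0 \<in> Y" using Y by blast
  have "(u0, w0) \<in> {(x, y). {x, y} \<in> E}\<^sup>*"
    using ext u0 w0 Y V_eq unfolding k_extendable_def graph_connected_def by blast
  moreover have "w0 \<notin> Y \<union> nbr E Y" using w0 Y disj by blast
  ultimately have "\<exists>x y. x \<in> Y \<union> nbr E Y \<and> y \<notin> Y \<union> nbr E Y \<and> {x, y} \<in> E"
    using u0 by (induction rule: rtrancl_induct) blast+
  then obtain x y where xy: "x \<in> Y \<union> nbr E Y" "y \<notin> Y \<union> nbr E Y" "{x, y} \<in> E" by blast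
  then have x: "x \<in> nbr E Y" unfolding nbr_def by blast
  then have "x \<in> W" using nbr_subset[OF Y(1)] by blast
  moreover obtain u w where "u \<in> U" "w \<in> W" "{x, y} = {u, w}" using xy(3) by (rule edgeE)
  ultimately have y: "y \<in> U" using disj by (auto simp: doubleton_eq_iff)
  have "matching E {{y, x}}" using xy(3) unfolding matching_def by (simp add: insert_commute)
  then obtain P where P: "perfect_matching V E P" "{{y, x}} \<subseteq> P"
    using k_extendable_le[OF ext P0, of "{{y, x}}"] k by auto
  have "card Y + card {y} \<le> card (nbr E Y)"
    by (rule perfect_matching_card_nbr[OF P(1), where g = "\<lambda>_. x"]) (use P xy x y Y in auto)
  then show False using card by simp
qed

text \<open>If \<open>X\<close> violates the surplus condition with \<open>d = |N(X)| - |X| < k\<close>, some matching between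
  \<open>U - X\<close> and \<open>N(X)\<close> has \<open>d + 1\<close> edges; a perfect matching containing it leaves too few
  vertices of \<open>N(X)\<close> for \<open>X\<close>.\<close>

lemma surplus_if_k_extendable:
  assumes ext: "k_extendable k V E" and k: "0 < k" and P0: "perfect_matching V E P0"
  shows "surplus k U W E"
  unfolding surplus_def
proof (intro allI impI, rule ccontr)
  fix X assume X: "X \<subseteq> U" "X \<noteq> {}"
    and "\<not> (nbr E X = W \<or> card X + k \<le> card (nbr E X))"
  then have ne: "nbr E X \<noteq> W" and small: "card (nbr E X) < card X + k" by auto
  define N T where "N = nbr E X" and "T = W - N"
  have NW: "N \<subseteq> W" and finN: "finite N" using nbr_subset X(1) finite_nbr N_def by auto
  have "T \<noteq> {}" using ne NW unfolding T_def N_def by blast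
  then have T: "0 < card T" using finite_W T_def by (simp add: card_gt_0_iff)
  have cW: "card W = card N + card T"
    using NW finN finite_W card_mono[OF finite_W NW] unfolding T_def by (simp add: card_Diff_subset)
  \<comment> \<open>The deficit \<open>card T - 1\<close> is chosen so that at least
    \<open>card N + 1 - card X\<close> vertices of \<open>U - X\<close> get matched into
    \<open>N\<close>. A violating \<open>Y\<close> would have at most \<open>card Y\<close>
    neighbours even when all of \<open>T\<close> is added, hence neighbourhood \<open>W\<close>;
    then \<open>Y = U\<close>, although \<open>Y\<close> avoids the nonempty
    \<open>X\<close>.\<close>
  have hall_cond: "card Y \<le> card (\<Union>((\<lambda>u. nbr E {u} \<inter> N) ` Y)) + (card T - 1)" if Y: "Y \<subseteq> U - X" for Y
  proof (rule ccontr)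
    assume "\<not> ?thesis"
    moreover have "\<Union>((\<lambda>u. nbr E {u} \<inter> N) ` Y) = nbr E Y \<inter> N" unfolding nbr_def by auto
    ultimately have c: "card (nbr E Y \<inter> N) + card T \<le> card Y" using T by simp
    have YU: "Y \<subseteq> U" using Y by blast
    have "nbr E Y \<subseteq> (nbr E Y \<inter> N) \<union> T" using nbr_subset[OF YU] T_def by blast
    then have "card (nbr E Y) \<le> card ((nbr E Y \<inter> N) \<union> T)"
      using finN finite_W T_def by (intro card_mono) auto
    also have "\<dots> \<le> card (nbr E Y \<inter> N) + card T" by (rule card_Un_le)
    finally have le: "card (nbr E Y) \<le> card Y" using c by simp
    have "Y \<noteq> {}" using c T by auto
    then have "nbr E Y = W" using nbr_eq_W_if_card_le[OF ext k P0 YU _ le] by blast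
    then have "card U \<le> card Y" using le card_perfect_matching(2)[OF P0] by simp
    then have "Y = U" using YU finite_U by (simp add: card_seteq)
    then show False using Y X by blast
  qed
  obtain J f where J: "J \<subseteq> U - X" "card (U - X) \<le> card J + (card T - 1)" "inj_on f J"
      "\<forall>u\<in>J. f u \<in> nbr E {u} \<inter> N"
    using hall_deficit[of "U - X" "\<lambda>u. nbr E {u} \<inter> N" "card T - 1"] hall_cond finN finite_U by auto
  have "card (U - X) = card U - card X" using X finite_U by (simp add: card_Diff_subset finite_subset)
  moreover have "card U = card N + card T" using cW card_perfect_matching(2)[OF P0] by simp
  moreover have "card X \<le> card U" using X finite_U by (simp add: card_mono)
  ultimately have big: "card N < card X + card J" using J(2) T by linarith
  \<comment> \<open>One edge more than \<open>X\<close> can spare, but by \<open>small\<close> still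
    at most \<open>k\<close> edges.\<close>
  have "card N + 1 - card X \<le> card J" using big by simp
  then obtain A where A: "A \<subseteq> J" "card A = card N + 1 - card X"
    by (meson obtain_subset_with_card_n)
  have AU: "A \<subseteq> U" using A J by blast
  have fA: "f ` A \<subseteq> W" using A J NW by blast
  have "matching E ((\<lambda>u. {u, f u}) ` A)"
    using A(1) J(4) AU inj_on_subset[OF J(3) A(1)] by (intro matching_of_fun) (auto simp: nbr_def)
  moreover have "card ((\<lambda>u. {u, f u}) ` A) \<le> k"
    using inj_on_edges[OF AU fA] A(2) small k N_def by (simp add: card_image)
  ultimately obtain P where P: "perfect_matching V E P" "(\<lambda>u. {u, f u}) ` A \<subseteq> P"
    using k_extendable_le[OF ext P0] by blast
  have "card X + card A \<le> card N"
    unfolding N_def by (rule perfect_matching_card_nbr[OF P]) (use A J X N_def in auto)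
  then show False using A(2) by simp
qed

section \<open>From surplus back to extendability\<close>

text \<open>For the vertices \<open>X\<close> of \<open>U\<close> reachable from \<open>u\<close>,
  the matching edges lead from every neighbour of \<open>X\<close> back into \<open>X\<close>. So
  \<open>X\<close> has no surplus, its neighbourhood is all of \<open>W\<close>, and matching edges
  then reach the rest of \<open>U\<close>.\<close>

lemma connected_if_surplus:
  assumes sur: "surplus k U W E" and k: "0 < k" and P: "perfect_matching V E P"
  shows "graph_connected V E"
proof -
  define R where "R = {(x, y). {x, y} \<in> E}"
  have symR: "sym (R\<^sup>*)" unfolding R_def by (intro sym_rtrancl symI) (auto simp: insert_commute)
  obtain f where f: "bij_betw f U W" "P = (\<lambda>u. {u, f u}) ` U"
    using P by (rule perfect_matching_as_fun)
  have fR: "(u, f u) \<in> R" if "u \<in> U" for u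
    using that P f unfolding perfect_matching_def matching_def R_def by blast
  have reach: "(u, v) \<in> R\<^sup>*" if u: "u \<in> U" and v: "v \<in> V" for u v
  proof -
    define X where "X = {x \<in> U. (u, x) \<in> R\<^sup>*}"
    have XU: "X \<subseteq> U" "X \<noteq> {}" using u X_def by auto
    have "nbr E X \<subseteq> f ` X"
    proof
      fix w assume "w \<in> nbr E X"
      then obtain x where x: "x \<in> X" "{x, w} \<in> E" unfolding nbr_def by blast
      then have "w \<in> W" using edge_W XU by blast
      then obtain y where y: "y \<in> U" "w = f y" using f unfolding bij_betw_def by blast
      have "(u, w) \<in> R\<^sup>*" using x unfolding X_def R_def by (auto intro: rtrancl_into_rtrancl)
      moreover have "(w, y) \<in> R" using fR[OF y(1)] y(2) unfolding R_def by (auto simp: insert_commute)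
      ultimately have "(u, y) \<in> R\<^sup>*" by (rule rtrancl_into_rtrancl)
      then show "w \<in> f ` X" using y X_def by blast
    qed
    moreover have finX: "finite X" using finite_subset[OF XU(1) finite_U] .
    ultimately have "card (nbr E X) \<le> card X" by (simp add: surj_card_le)
    then have "\<not> card X + k \<le> card (nbr E X)" using k by simp
    then have NX: "nbr E X = W" using surplusD[OF sur XU] by blast
    have W: "(u, w) \<in> R\<^sup>*" if "w \<in> W" for w
      using that NX unfolding nbr_def X_def R_def by (auto intro: rtrancl_into_rtrancl)
    show ?thesis
    proof (cases "v \<in> W")
      case False
      then have vU: "v \<in> U" using v V_eq by blast
      then have "f v \<in> W" using f unfolding bij_betw_def by blast
      moreover have "(f v, v) \<in> R" using fR[OF vU] unfolding R_def by (auto simp: insert_commute)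
      ultimately show ?thesis using W by (meson rtrancl_into_rtrancl)
    qed (rule W)
  qed
  have "(x, y) \<in> R\<^sup>*" if x: "x \<in> V" and y: "y \<in> V" for x y
  proof (cases "x \<in> U")
    case False
    then obtain u where u: "u \<in> U" using x V_eq f unfolding bij_betw_def by blast
    have "(x, u) \<in> R\<^sup>*" using reach[OF u x] symR by (meson symD)
    then show ?thesis using reach[OF u y] by (rule rtrancl_trans)
  qed (use reach y in blast)
  then show ?thesis unfolding graph_connected_def R_def by blast
qed

text \<open>Given \<open>k\<close> matching edges covering \<open>A\<close> and \<open>B\<close>,
  Hall's theorem matches \<open>U - A\<close> into the complement of \<open>B\<close>: removing
  \<open>B\<close> costs at most \<open>k\<close> neighbours, which the surplus covers, and when all
  of \<open>W\<close> is adjacent, counting \<open>U - A\<close> against \<open>W - B\<close>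
  suffices.\<close>

lemma k_extendable_if_surplus:
  assumes sur: "surplus k U W E" and k: "0 < k" and P0: "perfect_matching V E P0"
    and card: "k + 1 \<le> card U"
  shows "k_extendable k V E"
proof -
  have cW: "card W = card U" using card_perfect_matching[OF P0] by simp
  have "\<exists>P. perfect_matching V E P \<and> F \<subseteq> P" if F: "matching E F" "card F = k" for F
  proof -
    obtain A f where A: "A \<subseteq> U" "inj_on f A" "f ` A \<subseteq> W" "F = (\<lambda>u. {u, f u}) ` A"
      using F(1) by (rule matching_as_fun)
    have FE: "F \<subseteq> E" using F unfolding matching_def by blast
    have cA: "card A = k" using F A inj_on_edges[OF A(1,3)] by (simp add: card_image)
    define B where "B = f ` A"
    have cB: "card B = k" using A cA B_def by (simp add: card_image)
    have finB: "finite B" using finite_subset[OF A(3) finite_W] B_def by simp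
    have finA: "finite A" using finite_subset[OF A(1) finite_U] .
    have "card X \<le> card (\<Union>((\<lambda>u. nbr E {u} - B) ` X))" if X: "X \<subseteq> U - A" for X
    proof (cases "X = {}")
      case False
      have XU: "X \<subseteq> U" using X by blast
      have "\<Union>((\<lambda>u. nbr E {u} - B) ` X) = nbr E X - B" unfolding nbr_def by auto
      moreover have "card (nbr E X) - k \<le> card (nbr E X - B)"
        using diff_card_le_card_Diff[OF finB, of "nbr E X"] cB by simp
      moreover have "card X \<le> card (nbr E X) - k"
      proof -
        have "card X \<le> card (U - A)" using X finite_U by (intro card_mono) auto
        also have "\<dots> = card U - k" using A finA cA by (simp add: card_Diff_subset)
        finally have "card X \<le> card W - k" using cW by simp
        moreover have "nbr E X = W \<or> card X + k \<le> card (nbr E X)"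
          using sur XU False by (rule surplusD)
        ultimately show ?thesis by auto
      qed
      ultimately show ?thesis by simp
    qed simp
    then obtain g where g: "inj_on g (U - A)" "\<forall>u\<in>U-A. g u \<in> nbr E {u} - B"
      using hall[of "U - A" "\<lambda>u. nbr E {u} - B"] finite_U finite_nbr by auto
    define h where "h u = (if u \<in> A then f u else g u)" for u
    have hE: "{u, h u} \<in> E" if "u \<in> U" for u
      using that g(2) A(4) FE unfolding h_def nbr_def by auto
    have inj: "inj_on h U"
      using g A(2) unfolding inj_on_def h_def B_def by (smt (verit) Diff_iff image_eqI)
    have "h ` U \<subseteq> W" using hE edge_W by blast
    \<comment> \<open>An injection of \<open>U\<close> into a set of the same finite size is
      onto.\<close>
    then have "h ` U = W"
      using inj cW finite_W by (intro card_seteq) (auto simp: card_image)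
    then have "perfect_matching V E ((\<lambda>u. {u, h u}) ` U)"
      using inj hE by (intro perfect_matching_of_fun) (auto simp: bij_betw_def)
    moreover have "F \<subseteq> (\<lambda>u. {u, h u}) ` U" using A(1) unfolding A(4) h_def by auto
    ultimately show ?thesis by blast
  qed
  moreover have "\<exists>N. matching E N \<and> card N = k"
  proof -
    have "k \<le> card P0" using card card_perfect_matching(1)[OF P0] by simp
    then obtain N where "N \<subseteq> P0" "card N = k" by (meson obtain_subset_with_card_n)
    then show ?thesis using P0 matching_subset unfolding perfect_matching_def by blast
  qed
  moreover have "2 * k + 1 \<le> card V" using card card_perfect_matching[OF P0] by simp
  ultimately show ?thesis
    unfolding k_extendable_def using simple connected_if_surplus[OF sur k P0] by blast
qed

theorem k_extendable_iff_surplus: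
  assumes "0 < k" "perfect_matching V E P"
  shows "k_extendable k V E \<longleftrightarrow> k + 1 \<le> card U \<and> surplus k U W E"
proof
  assume ext: "k_extendable k V E"
  then have "2 * k + 1 \<le> 2 * card U"
    using card_perfect_matching[OF assms(2)] unfolding k_extendable_def by simp
  then show "k + 1 \<le> card U \<and> surplus k U W E"
    using surplus_if_k_extendable[OF ext assms] by simp
qed (use k_extendable_if_surplus assms in blast)

section \<open>The digraph of a perfect matching\<close>

text \<open>As \<open>U\<close> and \<open>W\<close> are disjoint, an edge determines its two ends,
  so the existential over representations in \<open>DGM_arcs\<close> collapses to a pair of vertices
  of \<open>U\<close>.\<close>

lemma DGM_arcs_of_fun:
  assumes "bij_betw m U W"
  shows "DGM_arcs U W E ((\<lambda>u. {u, m u}) ` U) =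
    {({u, m u}, {u', m u'}) | u u'. u \<in> U \<and> u' \<in> U \<and> u \<noteq> u' \<and> {u, m u'} \<in> E}"
    (is "?L = ?R")
proof -
  have mW: "m u \<in> W" if "u \<in> U" for u using that assms unfolding bij_betw_def by blast
  show ?thesis
  proof (intro equalityI subsetI)
    fix a assume aL: "a \<in> ?L"
    obtain p q where pq: "a = (p, q)" by (cases a)
    with aL have "p \<in> (\<lambda>u. {u, m u}) ` U \<and> q \<in> (\<lambda>u. {u, m u}) ` U \<and> p \<noteq> q \<and>
      (\<exists>x w x' w'. x \<in> U \<and> x' \<in> U \<and> w \<in> W \<and> w' \<in> W \<and> p = {x, w} \<and> q = {x', w'} \<and> {x, w'} \<in> E)"
      unfolding DGM_arcs_def by simp
    then obtain x w x' w' where a: "p \<in> (\<lambda>u. {u, m u}) ` U" "q \<in> (\<lambda>u. {u, m u}) ` U"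
        "p \<noteq> q" "x \<in> U" "x' \<in> U" "w \<in> W" "w' \<in> W" "p = {x, w}" "q = {x', w'}" "{x, w'} \<in> E"
      by (elim conjE exE)
    obtain u u' where u: "u \<in> U" "p = {u, m u}" "u' \<in> U" "q = {u', m u'}" using a(1,2) by blast
    have "u = x" using edge_eq_iff[OF u(1) mW[OF u(1)] a(4,6)] u(2) a(8) by simp
    moreover have "m u' = w'" using edge_eq_iff[OF u(3) mW[OF u(3)] a(5,7)] u(4) a(9) by metis
    moreover have "u \<noteq> u'" using u a(3) by blast
    ultimately have "a = ({u, m u}, {u', m u'}) \<and> u \<in> U \<and> u' \<in> U \<and> u \<noteq> u' \<and> {u, m u'} \<in> E"
      using pq u a(10) by simp
    then show "a \<in> ?R" by blast
  next
    fix a assume "a \<in> ?R"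
    then obtain u u' where a: "a = ({u, m u}, {u', m u'})" "u \<in> U" "u' \<in> U" "u \<noteq> u'" "{u, m u'} \<in> E"
      by blast
    then have "{u, m u} \<noteq> {u', m u'}" using edge_eq_iff[of u "m u" u' "m u'"] mW by simp
    moreover have "\<exists>x w x' w'. x \<in> U \<and> x' \<in> U \<and> w \<in> W \<and> w' \<in> W \<and>
        {u, m u} = {x, w} \<and> {u', m u'} = {x', w'} \<and> {x, w'} \<in> E"
      using a mW[OF a(2)] mW[OF a(3)] by (intro exI[of _ u] exI[of _ "m u"] exI[of _ u'] exI[of _ "m u'"]) simp
    ultimately show "a \<in> ?L" using a(1-3) unfolding DGM_arcs_def by simp
  qed
qed

text \<open>Subsets of \<open>P\<close> are the images of subsets \<open>X\<close> of
  \<open>U\<close> under \<open>e\<close>, and \<open>m\<close> carries the closed out-neighbourhood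
  of such an image bijectively onto \<open>nbr E X\<close>. The criterion for
  \<open>k_strong\<close> thus becomes the surplus condition.\<close>

theorem k_strong_DGM_iff_surplus:
  assumes P: "perfect_matching V E P"
  shows "k_strong k P (DGM_arcs U W E P) \<longleftrightarrow> k + 1 \<le> card U \<and> surplus k U W E"
proof -
  obtain m where m: "bij_betw m U W" "P = (\<lambda>u. {u, m u}) ` U"
    using P by (rule perfect_matching_as_fun)
  define e where "e u = {u, m u}" for u
  have Pe: "P = e ` U" using m e_def by auto
  have mE: "{u, m u} \<in> E" if "u \<in> U" for u
    using that P m(2) unfolding perfect_matching_def matching_def by blast
  have inje: "inj_on e U"
    unfolding e_def using inj_on_edges[of U m] m(1) unfolding bij_betw_def by blast
  define D where "D = DGM_arcs U W E P"
  have D: "D = {(e u, e u') | u u'. u \<in> U \<and> u' \<in> U \<and> u \<noteq> u' \<and> {u, m u'} \<in> E}"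
    unfolding D_def m(2) e_def by (rule DGM_arcs_of_fun[OF m(1)])
  have cl: "D `` (e ` X) \<union> e ` X = e ` {u \<in> U. m u \<in> nbr E X}" if X: "X \<subseteq> U" for X
  proof -
    have 1: "D `` (e ` X) = e ` {u' \<in> U. \<exists>u\<in>X. u \<noteq> u' \<and> {u, m u'} \<in> E}"
    proof (intro equalityI subsetI)
      fix y assume "y \<in> D `` (e ` X)"
      then obtain x u u' where "x \<in> X" "e x = e u" "y = e u'" "u \<in> U" "u' \<in> U" "u \<noteq> u'" "{u, m u'} \<in> E"
        unfolding D by blast
      moreover then have "x = u" using X inje by (meson inj_onD subsetD)
      ultimately show "y \<in> e ` {u' \<in> U. \<exists>u\<in>X. u \<noteq> u' \<and> {u, m u'} \<in> E}" by blast
    qed (use X D in blast)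
    \<comment> \<open>The matching edge at \<open>u'\<close> puts \<open>m u'\<close> into the
      neighbourhood when \<open>u' \<in> X\<close>; this is why the out-neighbourhood has to be
      closed.\<close>
    have "m u' \<in> nbr E X \<longleftrightarrow> u' \<in> X \<or> (\<exists>u\<in>X. u \<noteq> u' \<and> {u, m u'} \<in> E)" if "u' \<in> U" for u'
      using mE[OF that] unfolding nbr_def by auto
    then have 2: "{u' \<in> U. \<exists>u\<in>X. u \<noteq> u' \<and> {u, m u'} \<in> E} \<union> X = {u \<in> U. m u \<in> nbr E X}"
      using X by auto
    show ?thesis unfolding 1 2[symmetric] image_Un by (rule refl)
  qed
  have bij: "bij_betw m {u \<in> U. m u \<in> nbr E X} (nbr E X)" if "X \<subseteq> U" for X
  proof -
    have "nbr E X \<subseteq> m ` U" "inj_on m U" using m(1) nbr_subset[OF that] unfolding bij_betw_def by auto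
    then show ?thesis unfolding bij_betw_def inj_on_def by auto
  qed
  have cardcl: "card (D `` (e ` X) \<union> e ` X) = card (nbr E X)" if X: "X \<subseteq> U" for X
  proof -
    have "card (e ` {u \<in> U. m u \<in> nbr E X}) = card {u \<in> U. m u \<in> nbr E X}"
      using inje by (intro card_image) (auto simp: inj_on_def)
    then show ?thesis using cl[OF X] bij_betw_same_card[OF bij[OF X]] by simp
  qed
  have full: "D `` (e ` X) \<union> e ` X = P \<longleftrightarrow> nbr E X = W" if X: "X \<subseteq> U" for X
  proof -
    have "D `` (e ` X) \<union> e ` X = P \<longleftrightarrow> {u \<in> U. m u \<in> nbr E X} = U"
      unfolding cl[OF X] Pe using inj_on_image_eq_iff[OF inje, of "{u \<in> U. m u \<in> nbr E X}" U] by blast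
    also have "\<dots> \<longleftrightarrow> nbr E X = W"
      using m(1) nbr_subset[OF X] unfolding bij_betw_def by auto
    finally show ?thesis .
  qed
  have cardX: "card (e ` X) = card X" if "X \<subseteq> U" for X
    using that inje by (meson card_image inj_on_subset)
  have finP: "finite P" using Pe finite_U by simp
  have DP: "D \<subseteq> P \<times> P" unfolding D Pe by blast
  have cP: "card P = card U" by (rule card_perfect_matching(1)[OF P])
  have all: "(\<forall>Y. Y \<subseteq> P \<longrightarrow> Q Y) \<longleftrightarrow> (\<forall>X. X \<subseteq> U \<longrightarrow> Q (e ` X))" for Q
    unfolding Pe by (metis image_mono subset_imageE)
  show ?thesis
    unfolding D_def[symmetric] k_strong_iff_out_neighbours[OF finP DP] cP surplus_def all
    using full cardcl cardX by auto
qed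

end

text \<open>Both sides amount to the same surplus condition. The graph is kept general so that the
  equivalence applies before and after deleting an edge.\<close>

lemma k_extendable_iff_k_strong_DGM:
  assumes "simple_graph V E" "bipartition V E U W" "perfect_matching V E M" "0 < k"
  shows "k_extendable k V E \<longleftrightarrow> k_strong k M (DGM_arcs U W E M)"
proof -
  interpret bip_graph V U W E using assms by unfold_locales
  show ?thesis using k_extendable_iff_surplus k_strong_DGM_iff_surplus assms by blast
qed

section \<open>Transfer of minimality\<close>

theorem theorem5:
  fixes V U W :: "'a set" and E M :: "'a set set" and k :: nat
  assumes "simple_graph V E"
    and "bipartition V E U W"
    and "perfect_matching V E M"
    and "0 < k"
    and "minimal_k_extendable k V E"
  shows "minimal_k_strong k M (DGM_arcs U W E M)"
proof -
  interpret bip_graph V U W E using assms by unfold_locales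
  obtain m where m: "bij_betw m U W" "M = (\<lambda>u. {u, m u}) ` U"
    using assms(3) by (rule perfect_matching_as_fun)
  have mW: "m u \<in> W" if "u \<in> U" for u using that m(1) unfolding bij_betw_def by blast
  have m_inj: "m u = m u' \<longleftrightarrow> u = u'" if "u \<in> U" "u' \<in> U" for u u'
    using that m(1) unfolding bij_betw_def by (meson inj_onD)
  have "\<not> k_strong k M (DGM_arcs U W E M - {a})" if arc: "a \<in> DGM_arcs U W E M" for a
  proof -
    obtain u u' where a: "a = ({u, m u}, {u', m u'})" "u \<in> U" "u' \<in> U" "u \<noteq> u'" "{u, m u'} \<in> E"
      using arc unfolding m(2) DGM_arcs_of_fun[OF m(1)] by blast
    \<comment> \<open>The edge of the graph that produces the arc \<open>a\<close>. Since
      \<open>u \<noteq> u'\<close> it lies outside \<open>M\<close>, so \<open>M\<close> stays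
      perfect.\<close>
    define E' where "E' = E - {{u, m u'}}"
    have bip': "simple_graph V E'" "bipartition V E' U W"
      using assms(1,2) unfolding simple_graph_def bipartition_def E'_def by auto
    interpret G': bip_graph V U W E' using bip' by unfold_locales
    have "{x, m x} \<noteq> {u, m u'}" if "x \<in> U" for x
      unfolding edge_eq_iff[OF that mW[OF that] a(2) mW[OF a(3)]] using m_inj[OF a(2,3)] a(4) by auto
    then have pm': "perfect_matching V E' M"
      using assms(3) m(2) unfolding perfect_matching_def matching_def E'_def by auto
    \<comment> \<open>The edge and the arc determine each other, so deleting the edge removes
      \<open>a\<close> and no other arc.\<close>
    have "{x, m y} = {u, m u'} \<longleftrightarrow> ({x, m x}, {y, m y}) = a" if "x \<in> U" "y \<in> U" for x y
      unfolding a(1) prod.inject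
        edge_eq_iff[OF that(1) mW[OF that(2)] a(2) mW[OF a(3)]]
        edge_eq_iff[OF that(1) mW[OF that(1)] a(2) mW[OF a(2)]]
        edge_eq_iff[OF that(2) mW[OF that(2)] a(3) mW[OF a(3)]]
      using m_inj[OF that(2) a(3)] by auto
    then have E'_iff: "{x, m y} \<in> E' \<longleftrightarrow> {x, m y} \<in> E \<and> ({x, m x}, {y, m y}) \<noteq> a" if "x \<in> U" "y \<in> U" for x y
      using that unfolding E'_def by simp
    \<comment> \<open>With edges and arcs abstracted to \<open>Q\<close>, \<open>Q'\<close> and
      \<open>p\<close>, only a set identity remains, instantiated just below.\<close>
    have "{p x y | x y. x \<in> U \<and> y \<in> U \<and> x \<noteq> y \<and> Q' x y} =
        {p x y | x y. x \<in> U \<and> y \<in> U \<and> x \<noteq> y \<and> Q x y} - {a}"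
      if "\<And>x y. x \<in> U \<Longrightarrow> y \<in> U \<Longrightarrow> Q' x y \<longleftrightarrow> Q x y \<and> p x y \<noteq> a" for p Q Q'
      using that by blast
    from this[of "\<lambda>x y. {x, m y} \<in> E'" "\<lambda>x y. {x, m y} \<in> E" "\<lambda>x y. ({x, m x}, {y, m y})", OF E'_iff]
    have "DGM_arcs U W E' M = DGM_arcs U W E M - {a}"
      unfolding m(2) DGM_arcs_of_fun[OF m(1)] G'.DGM_arcs_of_fun[OF m(1)] .
    moreover have "\<not> k_extendable k V E'"
      using assms(5) a(5) unfolding minimal_k_extendable_def E'_def by blast
    ultimately show ?thesis
      using k_extendable_iff_k_strong_DGM[OF bip' pm' assms(4)] by simp
  qed
  moreover have "k_strong k M (DGM_arcs U W E M)"
    using k_extendable_iff_k_strong_DGM[OF assms(1-4)] assms(5)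
    unfolding minimal_k_extendable_def by blast
  ultimately show ?thesis unfolding minimal_k_strong_def by blast
qed

end
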